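(* Let $h>0$, let $(\varepsilon_i)_{i\in\mathbb{Z}}$ be a real sequence with $0<\varepsilon_{\min}\le\varepsilon_i\le\varepsilon_{\max}$ for all $i\in\mathbb{Z}$ and some constants $\varepsilon_{\min},\varepsilon_{\max}$, and let $\boldsymbol{u}=(u_i)_{i\in\mathbb{Z}}$ be a real sequence with $\varepsilon_i u_i\ne 0$ for every $i$ and $\boldsymbol{u}^{\mathsf T}\mathcal{B}\boldsymbol{u}=\sum_{i\in\mathbb{Z}}\varepsilon_i u_i^2<\infty$. Assume that there exist constants $C_0>0$, $\alpha>1$ and $N_0\in\mathbb{N}$ such that $$|u_i|\le \frac{C_0}{|i|^{\alpha}}\qquad\text{for all } |i|\ge N_0 .$$ Then there exists a constant $C>0$, independent of the residual vector $\mathbf e$ below, such that for every $\lambda\in\mathbb{R}$ and every real sequence $\mathbf e=(e_i)_{i\in\mathbb{Z}}$ with $\mathcal{A}\boldsymbol{u}=\lambda\mathcal{B}\boldsymbol{u}+\mathbf e$ and $e_{\max}:=\sup_{i\in\mathbb{Z}}|e_i|<\infty$, the following hold. (i) $$\mathbb{E}_{\mathrm p}\left[\left\{\left|\frac{e_i}{\varepsilon_i u_i}\right|\right\}_{i\in\mathbb{Z}}\right]\le C\,e_{\max}.$$ (ii) Consequently, $$\Big|\mathbb{E}_{\mathrm p}\big[\{r_i\}_{i\in\mathbb{Z}}\big]-\lambda\Big|\le \mathbb{E}_{\mathrm p}\left[\left\{\left|\frac{e_i}{\varepsilon_i u_i}\right|\right\}_{i\in\mathbb{Z}}\right]\le 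C\,e_{\max}.$$
   Context: For $h>0$, $\mathcal{A}$ and $\mathcal{B}$ act on real sequences indexed by $\mathbb{Z}$ by $$(\mathcal{A}\boldsymbol{u})_i=\frac{1}{h^2}\,(-u_{i-1}+2u_i-u_{i+1}),\qquad (\mathcal{B}\boldsymbol{u})_i=\varepsilon_i u_i,\qquad i\in\mathbb{Z}.$$ The pointwise Rayleigh quotients are $r_i=(\mathcal{A}\boldsymbol{u})_i/(\mathcal{B}\boldsymbol{u})_i$, and the probability weights are $p_i=\varepsilon_i u_i^2/(\boldsymbol{u}^{\mathsf T}\mathcal{B}\boldsymbol{u})$, $i\in\mathbb{Z}$. For a real sequence $(x_i)$, $\mathbb{E}_{\mathrm p}[\{x_i\}]=\sum_{i\in\mathbb{Z}}p_i x_i$. *)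

theory Defs
  imports "HOL-Analysis.Analysis"
begin

definition opA :: "real \<Rightarrow> (int \<Rightarrow> real) \<Rightarrow> int \<Rightarrow> real" where
  "opA h u i = (1 / h\<^sup>2) * (- u (i - 1) + 2 * u i - u (i + 1))"

definition opB :: "(int \<Rightarrow> real) \<Rightarrow> (int \<Rightarrow> real) \<Rightarrow> int \<Rightarrow> real" where
  "opB \<epsilon> u i = \<epsilon> i * u i"

definition rayleigh :: "real \<Rightarrow> (int \<Rightarrow> real) \<Rightarrow> (int \<Rightarrow> real) \<Rightarrow> int \<Rightarrow> real" where
  "rayleigh h \<epsilon> u i = opA h u i / opB \<epsilon> u i"

text \<open>The quadratic form of the operator B at u; it is meaningful only if the series is
  summable, since \<^const>\<open>infsum\<close> is 0 otherwise.\<close>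

definition formB :: "(int \<Rightarrow> real) \<Rightarrow> (int \<Rightarrow> real) \<Rightarrow> real" where
  "formB \<epsilon> u = (\<Sum>\<^sub>\<infinity>i\<in>UNIV. \<epsilon> i * (u i)\<^sup>2)"

definition weight :: "(int \<Rightarrow> real) \<Rightarrow> (int \<Rightarrow> real) \<Rightarrow> int \<Rightarrow> real" where
  "weight \<epsilon> u i = \<epsilon> i * (u i)\<^sup>2 / formB \<epsilon> u"

text \<open>Because \<^const>\<open>infsum\<close> is 0 for a divergent family, a bound on \<open>expect p x\<close> has content
  only together with \<open>has_expect p x\<close>.\<close>

definition has_expect :: "(int \<Rightarrow> real) \<Rightarrow> (int \<Rightarrow> real) \<Rightarrow> bool" where
  "has_expect p x \<longleftrightarrow> (\<lambda>i. p i * x i) summable_on UNIV"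

definition expect :: "(int \<Rightarrow> real) \<Rightarrow> (int \<Rightarrow> real) \<Rightarrow> real" where
  "expect p x = (\<Sum>\<^sub>\<infinity>i\<in>UNIV. p i * x i)"

end

theory Submission
  imports Defs
begin

text \<open>The factors \<open>\<epsilon> i * u i\<close> cancel in the weighted residual:
  \<open>weight \<epsilon> u i * \<bar>e i / (\<epsilon> i * u i)\<bar> = \<bar>u i\<bar> * \<bar>e i\<bar> / formB \<epsilon> u\<close>. As \<open>\<alpha> > 1\<close>, the decay
  hypothesis makes \<open>u\<close> absolutely summable, so one may take \<open>C = (\<Sum>i. \<bar>u i\<bar>) / formB \<epsilon> u\<close>.
  For the second part, \<open>rayleigh h \<epsilon> u i = l + e i / (\<epsilon> i * u i)\<close> and the weights sum to 1.\<close>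

text \<open>The integers split into two disjoint copies of the naturals. The shift by
  \<open>Suc\<close> in the negative half keeps 0 from being counted twice.\<close>

lemma summable_on_int:
  fixes f :: "int \<Rightarrow> real"
  assumes "(\<lambda>n. f (int n)) summable_on UNIV" "(\<lambda>n. f (- int (Suc n))) summable_on UNIV"
  shows "f summable_on UNIV"
proof -
  have "f summable_on range int"
    using assms(1) by (subst summable_on_reindex) (auto simp: o_def)
  moreover have "f summable_on range (\<lambda>n. - int (Suc n))"
    using assms(2) by (subst summable_on_reindex) (auto simp: o_def inj_on_def)
  moreover have "range int \<inter> range (\<lambda>n. - int (Suc n)) = {}"
    by auto
  ultimately have "f summable_on (range int \<union> range (\<lambda>n. - int (Suc n)))"
    by (rule summable_on_Un_disjoint)
  moreover have "range int \<union> range (\<lambda>n. - int (Suc n)) = UNIV"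
  proof -
    have "i \<in> range int \<union> range (\<lambda>n. - int (Suc n))" for i
      by (cases i rule: int_cases) auto
    then show ?thesis
      by blast
  qed
  ultimately show ?thesis
    by simp
qed

text \<open>Each half-line is compared with the convergent series of
  \<open>K * real n powr (- \<alpha>)\<close>. The guard \<open>i \<noteq> 0\<close> matters when
  \<open>N = 0\<close>: as division by zero yields 0, the bound at 0 would force
  \<open>f 0 = 0\<close>.\<close>

lemma abs_summable_on_int_powr_decay:
  fixes f :: "int \<Rightarrow> real"
  assumes "\<alpha> > 1"
    and decay: "\<And>i. i \<noteq> 0 \<Longrightarrow> \<bar>i\<bar> \<ge> int N \<Longrightarrow> \<bar>f i\<bar> \<le> K / \<bar>real_of_int i\<bar> powr \<alpha>"
  shows "(\<lambda>i. \<bar>f i\<bar>) summable_on UNIV"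
proof (rule summable_on_int)
  have maj: "summable (\<lambda>n. K * real n powr (- \<alpha>))"
    using \<open>\<alpha> > 1\<close> by (intro summable_mult) (simp add: summable_real_powr_iff)
  \<comment> \<open>\<open>Suc N\<close> instead of \<open>N\<close> guarantees that
    \<open>i\<close> is nonzero, so that \<open>decay\<close> applies.\<close>
  have bound: "\<bar>f i\<bar> \<le> K * real n powr (- \<alpha>)" if "\<bar>i\<bar> = int n" "n \<ge> Suc N" for i n
  proof -
    have "\<bar>real_of_int i\<bar> = real n"
      using that(1) by (metis of_int_abs of_int_of_nat_eq)
    with decay[of i] that show ?thesis
      by (auto simp: powr_minus_divide)
  qed
  have "summable (\<lambda>n. \<bar>f (int n)\<bar>)"
    using bound by (intro summable_comparison_test'[OF maj, of "Suc N"]) auto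
  then show "(\<lambda>n. \<bar>f (int n)\<bar>) summable_on UNIV"
    by (intro norm_summable_imp_summable_on) simp
  \<comment> \<open>The unshifted family satisfies the same bound as the nonnegative half; dropping
    its first term then gives the shifted one.\<close>
  have "summable (\<lambda>n. \<bar>f (- int n)\<bar>)"
    using bound by (intro summable_comparison_test'[OF maj, of "Suc N"]) auto
  then have "summable (\<lambda>n. \<bar>f (- int (Suc n))\<bar>)"
    by (subst summable_Suc_iff)
  then show "(\<lambda>n. \<bar>f (- int (Suc n))\<bar>) summable_on UNIV"
    by (intro norm_summable_imp_summable_on) simp
qed

text \<open>All terms are nonnegative and the one at index 0 is already positive. Summability rules
  out the default value 0 of \<open>infsum\<close>.\<close>

lemma formB_pos:
  assumes "\<And>i. \<epsilon> i > 0" "\<And>i. u i \<noteq> 0" "(\<lambda>i. \<epsilon> i * (u i)\<^sup>2) summable_on UNIV"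
  shows "formB \<epsilon> u > 0"
proof -
  have "\<epsilon> 0 * (u 0)\<^sup>2 = (\<Sum>\<^sub>\<infinity>i\<in>{0}. \<epsilon> i * (u i)\<^sup>2)"
    by simp
  also have "\<dots> \<le> formB \<epsilon> u"
    unfolding formB_def using assms
    by (intro infsum_mono_neutral) (auto simp: less_imp_le)
  finally show ?thesis
    using assms(1,2)[of 0] by (smt (verit) mult_pos_pos zero_less_power2)
qed

lemma weight_has_sum_1:
  assumes "formB \<epsilon> u \<noteq> 0" "(\<lambda>i. \<epsilon> i * (u i)\<^sup>2) summable_on UNIV"
  shows "(weight \<epsilon> u has_sum 1) UNIV"
proof -
  have "((\<lambda>i. \<epsilon> i * (u i)\<^sup>2) has_sum formB \<epsilon> u) UNIV"
    unfolding formB_def using assms(2) by (rule has_sum_infsum)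
  from has_sum_cmult_left[OF this, of "inverse (formB \<epsilon> u)"] show ?thesis
    using assms(1) by (simp add: weight_def[abs_def] divide_inverse)
qed

theorem theorem4p2:
  fixes h \<epsilon>min \<epsilon>max C\<^sub>0 \<alpha> :: real
    and N\<^sub>0 :: nat
    and \<epsilon> u :: "int \<Rightarrow> real"
  assumes "h > 0"
    and "0 < \<epsilon>min"
    and "\<forall>i. \<epsilon>min \<le> \<epsilon> i \<and> \<epsilon> i \<le> \<epsilon>max"
    and "\<forall>i. \<epsilon> i * u i \<noteq> 0"
    and "(\<lambda>i. \<epsilon> i * (u i)\<^sup>2) summable_on UNIV"
    and "C\<^sub>0 > 0"
    and "\<alpha> > 1"
    and "\<forall>i. i \<noteq> 0 \<and> \<bar>i\<bar> \<ge> int N\<^sub>0 \<longrightarrow> \<bar>u i\<bar> \<le> C\<^sub>0 / \<bar>real_of_int i\<bar> powr \<alpha>"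
  shows "\<exists>C>0. \<forall>(l :: real) (e :: int \<Rightarrow> real).
           (\<forall>i. opA h u i = l * opB \<epsilon> u i + e i) \<and> bdd_above (range (\<lambda>i. \<bar>e i\<bar>)) \<longrightarrow>
             (has_expect (weight \<epsilon> u) (\<lambda>i. \<bar>e i / (\<epsilon> i * u i)\<bar>) \<and>
              expect (weight \<epsilon> u) (\<lambda>i. \<bar>e i / (\<epsilon> i * u i)\<bar>) \<le> C * (SUP i. \<bar>e i\<bar>)) \<and>
             (has_expect (weight \<epsilon> u) (rayleigh h \<epsilon> u) \<and>
              \<bar>expect (weight \<epsilon> u) (rayleigh h \<epsilon> u) - l\<bar>
                \<le> expect (weight \<epsilon> u) (\<lambda>i. \<bar>e i / (\<epsilon> i * u i)\<bar>) \<and>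
              expect (weight \<epsilon> u) (\<lambda>i. \<bar>e i / (\<epsilon> i * u i)\<bar>) \<le> C * (SUP i. \<bar>e i\<bar>))"
proof -
  have eps: "\<epsilon> i > 0" for i
    using assms(2,3) by (meson less_le_trans)
  have u0: "u i \<noteq> 0" for i
    using assms(4) by auto
  define F where "F = formB \<epsilon> u"
  define S where "S = (\<Sum>\<^sub>\<infinity>i\<in>UNIV. \<bar>u i\<bar>)"
  have F: "F > 0"
    unfolding F_def using eps u0 assms(5) by (rule formB_pos)
  have sum_u: "(\<lambda>i. \<bar>u i\<bar>) summable_on UNIV"
    using assms(7,8) by (intro abs_summable_on_int_powr_decay[where N = N\<^sub>0]) auto
  \<comment> \<open>A single nonzero entry makes \<open>S\<close>, and hence the constant
    \<open>S / F\<close>, strictly positive.\<close>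
  have "0 < \<bar>u 0\<bar>"
    using u0 by simp
  also have "\<bar>u 0\<bar> = (\<Sum>\<^sub>\<infinity>i\<in>{0}. \<bar>u i\<bar>)"
    by simp
  also have "\<dots> \<le> S"
    unfolding S_def using sum_u by (intro infsum_mono_neutral) auto
  finally have S: "S > 0" .
  show ?thesis
  \<comment> \<open>The witness is fixed before \<open>l\<close> and \<open>e\<close>, hence
    independent of the residual.\<close>
  proof (intro exI[of _ "S / F"] conjI allI impI; (elim conjE)?)
    show "S / F > 0"
      using S F by simp
  next
    fix l :: real and e :: "int \<Rightarrow> real"
    assume eq: "\<forall>i. opA h u i = l * opB \<epsilon> u i + e i"
      and bdd: "bdd_above (range (\<lambda>i. \<bar>e i\<bar>))"
    define M where "M = (SUP i. \<bar>e i\<bar>)"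
    \<comment> \<open>The signed weighted residual serves both parts: the sum of its absolute values
      is the expectation in (i), and its plain sum is the deviation from \<open>l\<close> in
      (ii).\<close>
    define x where "x i = weight \<epsilon> u i * (e i / (\<epsilon> i * u i))" for i
    have e_le: "\<bar>e i\<bar> \<le> M" for i
      unfolding M_def by (intro cSUP_upper bdd) auto
    have x: "x i = u i * e i / F" for i
      using u0[of i] eps[of i]
      by (simp add: x_def weight_def F_def power2_eq_square)
    \<comment> \<open>The weights are positive, so they can be moved inside the absolute
      value.\<close>
    have abs_x: "weight \<epsilon> u i * \<bar>e i / (\<epsilon> i * u i)\<bar> = \<bar>x i\<bar>" for i
      using eps[of i] F by (simp add: x_def weight_def F_def abs_mult)
    have x_le: "\<bar>x i\<bar> \<le> M / F * \<bar>u i\<bar>" for i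
      using mult_left_mono[OF e_le[of i], of "\<bar>u i\<bar>"] F
      by (simp add: x abs_mult divide_right_mono mult.commute)
    have sum_Mu: "(\<lambda>i. M / F * \<bar>u i\<bar>) summable_on UNIV"
      using sum_u by (rule summable_on_cmult_right)
    have sum_abs_x: "(\<lambda>i. \<bar>x i\<bar>) summable_on UNIV"
      using sum_Mu by (rule summable_on_comparison_test) (use x_le in auto)
    then have sum_x: "x summable_on UNIV"
      using abs_summable_summable[of x UNIV] by simp
    show has_E: "has_expect (weight \<epsilon> u) (\<lambda>i. \<bar>e i / (\<epsilon> i * u i)\<bar>)"
      unfolding has_expect_def abs_x by (rule sum_abs_x)
    have E: "expect (weight \<epsilon> u) (\<lambda>i. \<bar>e i / (\<epsilon> i * u i)\<bar>) = (\<Sum>\<^sub>\<infinity>i\<in>UNIV. \<bar>x i\<bar>)"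
      unfolding expect_def abs_x ..
    also have "\<dots> \<le> (\<Sum>\<^sub>\<infinity>i\<in>UNIV. M / F * \<bar>u i\<bar>)"
      using sum_abs_x sum_Mu x_le by (rule infsum_mono)
    also have "\<dots> = S / F * M"
      by (subst infsum_cmult_right') (simp add: S_def)
    finally show "expect (weight \<epsilon> u) (\<lambda>i. \<bar>e i / (\<epsilon> i * u i)\<bar>) \<le> S / F * (SUP i. \<bar>e i\<bar>)"
      unfolding M_def .
    \<comment> \<open>The goal contains this bound twice, once in each part.\<close>
    then show "expect (weight \<epsilon> u) (\<lambda>i. \<bar>e i / (\<epsilon> i * u i)\<bar>) \<le> S / F * (SUP i. \<bar>e i\<bar>)" .
    have r: "weight \<epsilon> u i * rayleigh h \<epsilon> u i = weight \<epsilon> u i * l + x i" for i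
    proof -
      have "rayleigh h \<epsilon> u i = l + e i / (\<epsilon> i * u i)"
        using eq[rule_format, of i] assms(4)
        by (simp add: rayleigh_def opB_def add_divide_distrib)
      then show ?thesis
        by (simp add: x_def algebra_simps)
    qed
    have "(weight \<epsilon> u has_sum 1) UNIV"
      using F assms(5) by (intro weight_has_sum_1) (auto simp: F_def)
    then have "((\<lambda>i. weight \<epsilon> u i * l) has_sum 1 * l) UNIV"
      by (rule has_sum_cmult_left)
    \<comment> \<open>Summing \<open>r\<close> over all indices: the weights have total mass 1, so
      the constant part contributes exactly \<open>l\<close>.\<close>
    from has_sum_add[OF this has_sum_infsum[OF sum_x]]
    have R: "((\<lambda>i. weight \<epsilon> u i * rayleigh h \<epsilon> u i) has_sum l + infsum x UNIV) UNIV"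
      by (simp add: r)
    show "has_expect (weight \<epsilon> u) (rayleigh h \<epsilon> u)"
      unfolding has_expect_def using R by (rule has_sum_imp_summable)
    have "expect (weight \<epsilon> u) (rayleigh h \<epsilon> u) - l = infsum x UNIV"
      using infsumI[OF R] by (simp add: expect_def)
    \<comment> \<open>This is the triangle inequality for infinite sums.\<close>
    also have "\<bar>infsum x UNIV\<bar> \<le> (\<Sum>\<^sub>\<infinity>i\<in>UNIV. \<bar>x i\<bar>)"
      using norm_infsum_bound[of x UNIV] sum_abs_x by simp
    finally show "\<bar>expect (weight \<epsilon> u) (rayleigh h \<epsilon> u) - l\<bar>
        \<le> expect (weight \<epsilon> u) (\<lambda>i. \<bar>e i / (\<epsilon> i * u i)\<bar>)"
      unfolding E .
  qed
qed

end
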